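(* Let $K$ be a totally ordered (commutative, infinite) idempotent semifield. Then the following conditions are equivalent: (1) $K$ is order-dense and algebraically closed; (2) $K$ is order-dense and preradicable; (3) $K$ is radicable.
   Context: A semiring is a commutative monoid $(S,+,0)$ with an associative multiplication having identity $1$, distributing over $+$, and with $0$ absorbing. A semifield is a semiring with $1\neq 0$ in which every nonzero element has a multiplicative inverse; it is idempotent if $x+x=x$ for all $x$. All idempotent semifields are assumed commutative and infinite. An idempotent semifield $K$ is ordered by $x\leqslant y \iff x+y=y$; it is totally ordered if this order is total. $\mathbb{N}$ contains $0$ and $\mathbb{N}^*=\mathbb{N}\setminus\{0\}$. $K$ is order-dense if whenever $r<t$ there is $s$ with $r<s<t$. $K$ is preradicable if for all $y\in K$, $n\in\mathbb{N}^*$ there is a least element $x\in K$ with $x^n\geqslant y$. $K$ is radicable if for all $y\in K$, $n\in\mathbb{N}^*$ there is $x\in K$ with $x^n=y$. A polynomial $p\in K[X]$ is a formal polynomial $p=\sum_{j\in\mathbb{N}}p_jX^j$ (eventually zero sequence of coefficients), with polynomial function $\widehat p:K\to K$, $\widehat p(x)=\sum_j p_jx^j$. $K$ is algebraically closed if for every $p\in K[X]$ of degree $n>0$ there are $r_1,\dots,r_n\in K$ with $\widehat p(x)=p_n(x+r_1)\cdots(x+r_n)$ for all $x\in K$. *)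

theory Defs
  imports
    "HOL-Library.Infinite_Typeclass"
    "HOL-Computational_Algebra.Polynomial"
begin

text \<open>
  The distinctness of \<open>0\<close> and \<open>1\<close> and the commutativity of multiplication are
  part of \<^class>\<open>comm_semiring_1\<close>. The order is not additional data: it is
  determined by the addition.
\<close>

class idempotent_semifield = comm_semiring_1 + infinite + ord +
  assumes ex_mult_inverse: "x \<noteq> 0 \<Longrightarrow> \<exists>y. x * y = 1"
    and add_idem: "x + x = x"
    and less_eq_iff_add: "x \<le> y \<longleftrightarrow> x + y = y"
    and less_iff_le_neq: "x < y \<longleftrightarrow> x \<le> y \<and> x \<noteq> y"
begin

subclass order
proof
  fix x y z
  show "x < y \<longleftrightarrow> x \<le> y \<and> \<not> y \<le> x"
    by (metis add_commute less_eq_iff_add less_iff_le_neq add_idem)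
  show "x \<le> x"
    by (simp add: less_eq_iff_add add_idem)
  show "x \<le> z" if "x \<le> y" "y \<le> z"
    using that by (metis add_assoc less_eq_iff_add)
  show "x = y" if "x \<le> y" "y \<le> x"
    using that by (metis add_commute less_eq_iff_add)
qed

end

definition order_dense :: "'a::order itself \<Rightarrow> bool" where
  "order_dense _ \<longleftrightarrow> (\<forall>r t :: 'a. r < t \<longrightarrow> (\<exists>s. r < s \<and> s < t))"

definition preradicable :: "'a::idempotent_semifield itself \<Rightarrow> bool" where
  "preradicable _ \<longleftrightarrow>
     (\<forall>(y :: 'a) n :: nat. n > 0 \<longrightarrow> (\<exists>x. x ^ n \<ge> y \<and> (\<forall>z. z ^ n \<ge> y \<longrightarrow> x \<le> z)))"

definition radicable :: "'a::idempotent_semifield itself \<Rightarrow> bool" where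
  "radicable _ \<longleftrightarrow> (\<forall>(y :: 'a) n :: nat. n > 0 \<longrightarrow> (\<exists>x. x ^ n = y))"

text \<open>
  Only the polynomial functions are required to agree; the formal polynomial
  itself need not factor.
\<close>

definition alg_closed_semifield :: "'a::idempotent_semifield itself \<Rightarrow> bool" where
  "alg_closed_semifield _ \<longleftrightarrow>
     (\<forall>p :: 'a poly. degree p > 0 \<longrightarrow>
        (\<exists>r :: nat \<Rightarrow> 'a. \<forall>x. poly p x = lead_coeff p * (\<Prod>i=1..degree p. (x + r i))))"

end

theory Submission
  imports Defs
begin

text \<open>
  Addition is the maximum, and the nonzero elements form a linearly ordered abelian group. If a
  least \<open>x\<close> with \<open>y \<le> x ^ n\<close> satisfied \<open>y < x ^ n\<close>, order density would give some \<open>e < 1\<close> with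
  \<open>y / x ^ n \<le> e ^ n\<close>, and \<open>x * e\<close> would be smaller. If \<open>X ^ n + y\<close> factors with two roots
  \<open>r i < r j\<close>, then at a point strictly between them the product strictly exceeds both \<open>x ^ n\<close>
  and \<open>y\<close>; so all roots coincide and are \<open>n\<close>-th roots of \<open>y\<close>. Conversely, with \<open>n\<close>-th roots
  available, the largest tropical root splits off from every polynomial function.
\<close>

\<comment> \<open>Order and cancellation in idempotent semifields\<close>
subclass (in idempotent_semifield) ordered_comm_semiring
proof
  fix a b c :: 'a
  assume le: "a \<le> b"
  then have ab: "a + b = b"
    by (simp add: less_eq_iff_add)
  have "c + a + (c + b) = (c + c) + (a + b)"
    by (simp only: ac_simps)
  then show "c + a \<le> c + b"
    by (simp only: less_eq_iff_add add_idem ab)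
  show "c * a \<le> c * b"
    by (simp add: less_eq_iff_add ab flip: distrib_left)
qed

subclass (in idempotent_semifield) semiring_no_zero_divisors_cancel
proof
  fix a b c :: 'a
  have cancel: "a = b" if "c \<noteq> 0" "c * a = c * b" for a b c
  proof -
    obtain d where "c * d = 1"
      using ex_mult_inverse \<open>c \<noteq> 0\<close> by blast
    then show ?thesis
      using that(2) by (metis mult.assoc mult.commute mult_1_left)
  qed
  then show "a * b \<noteq> 0" if "a \<noteq> 0" "b \<noteq> 0"
    using that by (metis mult_zero_right)
  show "c * a = c * b \<longleftrightarrow> c = 0 \<or> a = b"
    using cancel by auto
  then show "a * c = b * c \<longleftrightarrow> c = 0 \<or> a = b"
    by (simp add: mult.commute)
qed

subclass (in idempotent_semifield) semiring_1_no_zero_divisors ..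

subclass (in idempotent_semifield) ordered_semiring_1
proof
  show "0 < 1"
    by (simp add: less_iff_le_neq less_eq_iff_add)
qed

context idempotent_semifield
begin

lemma zero_le: "0 \<le> x"
  by (simp add: less_eq_iff_add)

lemma zero_less_iff: "0 < x \<longleftrightarrow> x \<noteq> 0"
  using zero_le less_le by auto

lemma add_le_iff: "x + y \<le> z \<longleftrightarrow> x \<le> z \<and> y \<le> z"
  by (metis add_assoc add_commute add_idem less_eq_iff_add)

lemma sum_le_iff: "finite A \<Longrightarrow> sum f A \<le> z \<longleftrightarrow> (\<forall>i\<in>A. f i \<le> z)"
  by (induction A rule: finite_induct) (auto simp: add_le_iff zero_le)

lemma mult_left_strict_mono: "c \<noteq> 0 \<Longrightarrow> a < b \<Longrightarrow> c * a < c * b"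
  by (metis less_le mult_left_mono zero_le mult_cancel_left)

lemma semifield_power_strict_mono:
  assumes "a < b" "n > 0"
  shows "a ^ n < b ^ n"
  using assms(2)
proof (induction n rule: nat_induct_non_zero)
  case (Suc n)
  \<comment> \<open>Only \<open>b\<close> is known to be nonzero, so the first comparison is weak
    and the strict one multiplies by \<open>b\<close>.\<close>
  have "a * a ^ n \<le> b * a ^ n"
    using assms(1) by (simp add: less_imp_le mult_right_mono zero_le)
  also have "\<dots> < b * b ^ n"
    using Suc.IH assms(1) zero_le[of a] by (intro mult_left_strict_mono) auto
  finally show ?case by simp
qed (use assms in simp)

lemma semifield_prod_mono: "(\<And>i. i \<in> A \<Longrightarrow> f i \<le> g i) \<Longrightarrow> prod f A \<le> prod g A"
  by (induction A rule: infinite_finite_induct) (auto intro: mult_mono zero_le)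

lemma semifield_prod_nonzero: "(\<And>i. i \<in> A \<Longrightarrow> f i \<noteq> 0) \<Longrightarrow> prod f A \<noteq> 0"
  by (induction A rule: infinite_finite_induct) auto

text \<open>The product of \<open>g\<close> over the indices other than \<open>j\<close> is nonzero,
  so multiplying by it keeps the inequality at \<open>j\<close> strict.\<close>

lemma semifield_prod_strict_mono:
  assumes "finite A" "j \<in> A" "f j < g j"
    and "\<And>i. i \<in> A \<Longrightarrow> f i \<le> g i" "\<And>i. i \<in> A \<Longrightarrow> g i \<noteq> 0"
  shows "prod f A < prod g A"
proof -
  have "prod f A = f j * prod f (A - {j})"
    using assms(1,2) by (rule prod.remove)
  also have "\<dots> \<le> f j * prod g (A - {j})"
    using assms(4) by (intro mult_left_mono semifield_prod_mono zero_le) auto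
  also have "\<dots> < g j * prod g (A - {j})"
    using assms mult_left_strict_mono[of "prod g (A - {j})" "f j" "g j"]
      semifield_prod_nonzero[of "A - {j}" g]
    by (simp add: mult.commute)
  also have "\<dots> = prod g A"
    using assms(1,2) by (rule prod.remove[symmetric])
  finally show ?thesis .
qed

end

section \<open>Totally ordered semifields\<close>

lemma add_eq_max: "x + y = max x y" for x y :: "'a::{idempotent_semifield, linorder}"
  by (metis add.commute less_eq_iff_add max.absorb1 max.absorb2 linear)

lemma semifield_power_le_iff:
  "n > 0 \<Longrightarrow> a ^ n \<le> b ^ n \<longleftrightarrow> a \<le> b" for a b :: "'a::{idempotent_semifield, linorder}"
  by (meson linorder_not_less power_mono zero_le semifield_power_strict_mono)

text \<open>Infinitude supplies an element other than 0 and 1; either it or its inverse lies below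
  1.\<close>

lemma ex_between_zero_one: "\<exists>e :: 'a::{idempotent_semifield, linorder}. 0 < e \<and> e < 1"
proof -
  obtain x :: 'a where x: "x \<noteq> 0" "x \<noteq> 1"
    using infinite_UNIV ex_new_if_finite[of "{0::'a, 1}"] by auto
  obtain y where y: "x * y = 1"
    using ex_mult_inverse x(1) by blast
  show ?thesis
  proof (cases "x < 1")
    case True
    then show ?thesis using x by (auto simp: zero_less_iff)
  next
    case False
    then have "1 < x" using x by simp
    moreover have "y \<noteq> 0" using y by auto
    ultimately show ?thesis
      using y mult_left_strict_mono[of y 1 x] by (auto simp: zero_less_iff mult.commute)
  qed
qed

section \<open>Roots, least roots and order density\<close>

lemma radicable_imp_preradicable:
  assumes "radicable TYPE('a::{idempotent_semifield, linorder})"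
  shows "preradicable TYPE('a)"
  using assms unfolding radicable_def preradicable_def
  by (metis order_refl semifield_power_le_iff)

text \<open>Between nonzero elements lies their geometric mean, a square root of
  \<open>r * t\<close>. For \<open>r = 0\<close> that would be 0, so \<open>t\<close> is scaled by
  an element strictly between 0 and 1.\<close>

lemma radicable_imp_order_dense:
  assumes "radicable TYPE('a::{idempotent_semifield, linorder})"
  shows "order_dense TYPE('a)"
  unfolding order_dense_def
proof (intro allI impI)
  fix r t :: 'a
  assume rt: "r < t"
  then have t: "t \<noteq> 0"
    using zero_le[of r] by auto
  show "\<exists>s. r < s \<and> s < t"
  proof (cases "r = 0")
    case True
    obtain e :: 'a where "0 < e" "e < 1"
      using ex_between_zero_one by blast
    then have "0 < t * e" "t * e < t"
      using t mult_left_strict_mono[of t e 1] by (auto simp: zero_less_iff)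
    then show ?thesis using True by blast
  next
    case False
    obtain s where "s ^ 2 = r * t"
      using assms unfolding radicable_def by (metis zero_less_numeral)
    then have s: "s * s = r * t"
      by (simp only: power2_eq_square)
    have "r ^ 2 < s ^ 2" "s ^ 2 < t ^ 2"
      using mult_left_strict_mono[of r r t] mult_left_strict_mono[of t r t] False t rt
      by (simp_all add: s power2_eq_square mult.commute)
    then show ?thesis
      by (meson linorder_not_less power_mono zero_le)
  qed
qed

text \<open>For \<open>s\<close> strictly between \<open>u\<close> and 1, \<open>u\<close> is the
  product of \<open>s\<close> and \<open>u / s\<close>, both below 1; the larger of the two serves
  as \<open>e\<close>.\<close>

lemma order_dense_ex_square_ge:
  assumes "order_dense TYPE('a::{idempotent_semifield, linorder})" and "(u::'a) < 1"
  shows "\<exists>e < 1. u \<le> e ^ 2"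
proof -
  obtain s where s: "u < s" "s < 1"
    using assms unfolding order_dense_def by blast
  then have "s \<noteq> 0"
    using zero_le[of u] by auto
  then obtain d where d: "s * d = 1"
    using ex_mult_inverse by blast
  then have "d \<noteq> 0" by auto
  then have v: "u * d < 1"
    using mult_left_strict_mono[of d u s] s(1) d by (simp add: mult.commute)
  have "u = s * (u * d)"
    using d by (metis mult.left_commute mult_1_right)
  also have "\<dots> \<le> max s (u * d) * max s (u * d)"
    by (intro mult_mono zero_le) auto
  finally have "u \<le> max s (u * d) ^ 2"
    by (simp add: power2_eq_square)
  then show ?thesis
    using s v by (intro exI[of _ "max s (u * d)"]) auto
qed

text \<open>One more approximate square root doubles the exponent, and \<open>2 * n\<close> is at
  least \<open>Suc n\<close>; surplus factors of an element below 1 may be dropped.\<close>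

lemma order_dense_ex_power_ge:
  assumes dense: "order_dense TYPE('a::{idempotent_semifield, linorder})"
    and u: "(u::'a) < 1" and "n > 0"
  shows "\<exists>e < 1. u \<le> e ^ n"
  using \<open>n > 0\<close>
proof (induction n rule: nat_induct_non_zero)
  case 1
  show ?case using u by (intro exI[of _ u]) auto
next
  case (Suc n)
  then obtain e where e: "e < 1" "u \<le> e ^ n" by blast
  then obtain f where f: "f < 1" "e \<le> f ^ 2"
    using order_dense_ex_square_ge[OF dense] by blast
  note e(2)
  also have "e ^ n \<le> (f ^ 2) ^ n"
    using f(2) by (intro power_mono zero_le)
  also have "\<dots> = f ^ (Suc n + (n - 1))"
    using Suc.hyps by (simp flip: power_mult add: mult_2)
  also have "\<dots> = f ^ Suc n * f ^ (n - 1)"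
    by (rule power_add)
  also have "\<dots> \<le> f ^ Suc n * 1 ^ (n - 1)"
    using f(1) by (intro mult_left_mono power_mono zero_le) auto
  finally show ?case
    using f(1) by auto
qed

lemma preradicable_imp_radicable:
  assumes dense: "order_dense TYPE('a::{idempotent_semifield, linorder})"
    and pre: "preradicable TYPE('a)"
  shows "radicable TYPE('a)"
  unfolding radicable_def
proof (intro allI impI)
  fix y :: 'a and n :: nat
  assume n: "n > 0"
  obtain x where x: "y \<le> x ^ n" and least: "\<And>z. y \<le> z ^ n \<Longrightarrow> x \<le> z"
    using pre n unfolding preradicable_def by blast
  have "x ^ n = y"
  proof (rule ccontr)
    assume "x ^ n \<noteq> y"
    then have less: "y < x ^ n"
      using x by simp
    then have "x ^ n \<noteq> 0"
      using zero_le[of y] by (metis leD)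
    \<comment> \<open>As \<open>w\<close> inverts \<open>x ^ n\<close>, the quotient
      \<open>y / x ^ n\<close> is \<open>y * w\<close>.\<close>
    then obtain w where w: "x ^ n * w = 1" and "x \<noteq> 0"
      using ex_mult_inverse n by (metis zero_power)
    then have "w \<noteq> 0" by auto
    then have "y * w < 1"
      using mult_left_strict_mono[of w y "x ^ n"] less w by (simp add: mult.commute)
    then obtain e where e: "e < 1" "y * w \<le> e ^ n"
      using order_dense_ex_power_ge[OF dense _ n] by blast
    have "y = x ^ n * (y * w)"
      using w by (metis mult.left_commute mult_1_right)
    also have "\<dots> \<le> (x * e) ^ n"
      unfolding power_mult_distrib using e(2) by (intro mult_left_mono zero_le)
    finally have "x \<le> x * e"
      by (rule least)
    moreover have "x * e < x"
      using mult_left_strict_mono[of x e 1] e(1) \<open>x \<noteq> 0\<close> by simp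
    ultimately show False by simp
  qed
  then show "\<exists>x. x ^ n = y" ..
qed

section \<open>Algebraic closure and splitting of polynomial functions\<close>

lemma alg_closed_imp_radicable:
  assumes dense: "order_dense TYPE('a::{idempotent_semifield, linorder})"
    and closed: "alg_closed_semifield TYPE('a)"
  shows "radicable TYPE('a)"
  unfolding radicable_def
proof (intro allI impI)
  fix y :: 'a and n :: nat
  assume n: "n > 0"
  show "\<exists>x. x ^ n = y"
  proof (cases "y = 0")
    case True
    then show ?thesis using n by (auto intro: exI[of _ 0])
  next
    case y: False
    define p where "p = monom (1::'a) n + [:y:]"
    have deg: "degree p = n"
      unfolding p_def using n by (subst degree_add_eq_left) (auto simp: degree_monom_eq)
    have lead: "lead_coeff p = 1"
      unfolding deg using n by (auto simp: p_def coeff_pCons split: nat.split)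
    obtain r :: "nat \<Rightarrow> 'a" where "\<And>x. poly p x = (\<Prod>i=1..n. (x + r i))"
      using closed n unfolding alg_closed_semifield_def deg[symmetric] using lead by (metis mult_1)
    then have r: "x ^ n + y = (\<Prod>i=1..n. (x + r i))" for x
      unfolding p_def by (simp add: poly_monom)
    \<comment> \<open>Evaluation at 0 isolates the product of the roots.\<close>
    have prod_r: "(\<Prod>i=1..n. r i) = y"
      using r[of 0] n by (simp add: power_0_left)
    have nz: "r i \<noteq> 0" if "i \<in> {1..n}" for i
      using prod_r y that by (metis finite_atLeastAtMost prod_zero)
    have no_less: "\<not> r i < r j" if ij: "i \<in> {1..n}" "j \<in> {1..n}" for i j
    proof
      assume "r i < r j"
      then obtain s where s: "r i < s" "s < r j"
        using dense unfolding order_dense_def by blast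
      have "s \<noteq> 0"
        using s(1) zero_le[of "r i"] by auto
      have nz': "s + r k \<noteq> 0" for k
        using \<open>s \<noteq> 0\<close> zero_le[of s] by (auto simp: add_eq_max max_def)
      \<comment> \<open>Each factor \<open>s + r k\<close> dominates both \<open>s\<close> and
        \<open>r k\<close>, strictly exceeding \<open>s\<close> at \<open>k = j\<close> and
        \<open>r i\<close> at \<open>k = i\<close>.\<close>
      have "(\<Prod>k=1..n. s) < (\<Prod>k=1..n. s + r k)"
        using s ij by (intro semifield_prod_strict_mono[of _ j] nz') (auto simp: add_eq_max)
      then have 1: "s ^ n < s ^ n + y"
        by (simp add: r)
      have "(\<Prod>k=1..n. r k) < (\<Prod>k=1..n. s + r k)"
        using s ij by (intro semifield_prod_strict_mono[of _ i] nz') (auto simp: add_eq_max)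
      then have 2: "y < s ^ n + y"
        by (simp only: r prod_r)
      from 1 2 show False
        by (auto simp: add_eq_max max_def split: if_splits)
    qed
    have "r i = r 1" if "i \<in> {1..n}" for i
      using no_less[of i 1] no_less[of 1 i] that n by auto
    then have "(\<Prod>i=1..n. r i) = (\<Prod>i=1..n. r 1)"
      by (rule prod.cong[OF refl])
    then have "r 1 ^ n = y"
      unfolding prod_r by simp
    then show ?thesis ..
  qed
qed

text \<open>
  The root \<open>R\<close> is the largest point at which the leading monomial is dominated by another one,
  the one of degree \<open>k\<close>. Below \<open>R\<close> the monomials of degree above \<open>k\<close> are irrelevant, and
  above \<open>R\<close> only the leading monomial counts; hence the factor \<open>(x + R) ^ (n - k)\<close> splits off.
\<close>
lemma radicable_sum_factorization:
  assumes rad: "radicable TYPE('a::{idempotent_semifield, linorder})"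
    and "(c :: nat \<Rightarrow> 'a) n \<noteq> 0"
  shows "\<exists>r. \<forall>x. (\<Sum>j\<le>n. c j * x ^ j) = c n * (\<Prod>i=1..n. (x + r i))"
  using assms(2)
proof (induction n rule: less_induct)
  case (less n)
  show ?case
  proof (cases "n = 0")
    case True
    then show ?thesis by simp
  next
    case n: False
    obtain d where d: "c n * d = 1"
      using ex_mult_inverse less.prems by blast
    \<comment> \<open>The point \<open>t j\<close> is where the monomials of degrees
      \<open>j\<close> and \<open>n\<close> take the same value.\<close>
    have "\<forall>j. \<exists>t. j < n \<longrightarrow> t ^ (n - j) = c j * d"
      using rad unfolding radicable_def by (metis zero_less_diff)
    then obtain t where t: "\<And>j. j < n \<Longrightarrow> t j ^ (n - j) = c j * d"
      by metis
    have ct: "c j = c n * t j ^ (n - j)" if "j < n" for j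
      using t[OF that] d by (simp add: mult.left_commute)
    define R where "R = Max (t ` {..<n})"
    have tR: "t j \<le> R" if "j < n" for j
      unfolding R_def using that by (intro Max_ge) auto
    have "R \<in> t ` {..<n}"
      unfolding R_def using n by (intro Max_in) auto
    then obtain k where k: "k < n" "t k = R" by auto
    have c_le: "c j \<le> c n * R ^ (n - j)" if "j \<le> n" for j
    proof (cases "j = n")
      case False
      then show ?thesis
        using that by (subst ct) (auto intro!: mult_left_mono power_mono tR zero_le)
    qed simp
    have ck: "c k = c n * R ^ (n - k)"
      using ct[OF k(1)] k(2) by simp
    \<comment> \<open>Stated for any \<open>m\<close> at which the bound \<open>c_le\<close> is
      attained, so as to cover both \<open>m = n\<close> and \<open>m = k\<close>.\<close>
    have ge: "(\<Sum>j\<le>m. c j * x ^ j) = c m * x ^ m"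
      if "R \<le> x" "m \<le> n" "c m = c n * R ^ (n - m)" for m x
    proof (rule antisym)
      have "c j * x ^ j \<le> c m * x ^ m" if "j \<le> m" for j
      proof -
        have "c j * x ^ j \<le> c n * R ^ (n - j) * x ^ j"
          using c_le[of j] that \<open>m \<le> n\<close> by (intro mult_right_mono zero_le) auto
        also have "\<dots> = c m * (R ^ (m - j) * x ^ j)"
          using that \<open>m \<le> n\<close> by (simp add: \<open>c m = _\<close> mult.assoc flip: power_add)
            (simp add: mult.assoc[symmetric] flip: power_add)
        also have "\<dots> \<le> c m * (x ^ (m - j) * x ^ j)"
          using \<open>R \<le> x\<close> by (intro mult_left_mono mult_right_mono power_mono zero_le)
        also have "\<dots> = c m * x ^ m"
          using that by (simp flip: power_add)
        finally show ?thesis .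
      qed
      then show "(\<Sum>j\<le>m. c j * x ^ j) \<le> c m * x ^ m"
        by (simp add: sum_le_iff)
      show "c m * x ^ m \<le> (\<Sum>j\<le>m. c j * x ^ j)"
        using sum_le_iff[of "{..m}" "\<lambda>j. c j * x ^ j" "\<Sum>j\<le>m. c j * x ^ j"] by auto
    qed
    show ?thesis
    \<comment> \<open>If \<open>R = 0\<close>, then \<open>c k\<close> vanishes and the induction
      hypothesis does not apply, but the function is just the leading monomial.\<close>
    proof (cases "R = 0")
      case True
      have "(\<Sum>j\<le>n. c j * x ^ j) = c n * (\<Prod>i=1..n. (x + 0))" for x
        using ge[of x n] by (simp add: True zero_le)
      then show ?thesis
        by (intro exI[of _ "\<lambda>_. 0"]) simp
    next
      case R: False
      have "c k \<noteq> 0"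
        using R less.prems by (simp add: ck)
      then obtain r where r: "\<And>x. (\<Sum>j\<le>k. c j * x ^ j) = c k * (\<Prod>i=1..k. (x + r i))"
        using less.IH[OF k(1)] by blast
      \<comment> \<open>The roots of the truncation at degree \<open>k\<close>, followed by
        \<open>n - k\<close> copies of \<open>R\<close>.\<close>
      define r' where "r' i = (if i \<le> k then r i else R)" for i
      have prod_r': "(\<Prod>i=1..n. (x + r' i)) = (\<Prod>i=1..k. (x + r i)) * (x + R) ^ (n - k)" for x
      proof -
        have "(\<Prod>i=1..n. (x + r' i)) = (\<Prod>i=1..k. (x + r' i)) * (\<Prod>i=k+1..n. (x + r' i))"
          using prod.ub_add_nat[of 1 k "\<lambda>i. x + r' i" "n - k"] k(1) by simp
        also have "(\<Prod>i=k+1..n. (x + r' i)) = (\<Prod>i=k+1..n. (x + R))"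
          by (rule prod.cong) (auto simp: r'_def)
        finally show ?thesis
          by (simp add: r'_def)
      qed
      have "(\<Sum>j\<le>n. c j * x ^ j) = c n * (\<Prod>i=1..n. (x + r' i))" for x
      proof (cases "R \<le> x")
        case True
        have "c k * (\<Prod>i=1..k. (x + r i)) = c k * x ^ k"
          using ge[of x k] r True k(1) ck by simp
        then have "(\<Prod>i=1..k. (x + r i)) = x ^ k"
          using \<open>c k \<noteq> 0\<close> by simp
        moreover have "x + R = x"
          using True by (simp add: add_eq_max)
        ultimately show ?thesis
          using ge[of x n] True k(1) unfolding prod_r' by (simp flip: power_add)
      next
        case False
        then have "x \<le> R" by simp
        let ?S = "\<Sum>j\<le>k. c j * x ^ j"
        have low: "c j * x ^ j \<le> ?S" if "j \<le> k" for j
          using that sum_le_iff[of "{..k}" "\<lambda>j. c j * x ^ j" ?S] by auto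
        have "c j * x ^ j \<le> ?S" if "j \<le> n" for j
        proof (cases "j \<le> k")
          case False
          have "c j * x ^ j \<le> c n * R ^ (n - j) * x ^ j"
            using c_le[OF that] by (intro mult_right_mono zero_le)
          also have "\<dots> = c n * R ^ (n - j) * (x ^ (j - k) * x ^ k)"
            using False by (simp flip: power_add)
          \<comment> \<open>Raising the \<open>j - k\<close> excess factors \<open>x\<close> to
            \<open>R\<close> turns the coefficient into \<open>c n * R ^ (n - k)\<close>, which is
            \<open>c k\<close>.\<close>
          also have "\<dots> \<le> c n * R ^ (n - j) * (R ^ (j - k) * x ^ k)"
            using \<open>x \<le> R\<close> by (intro mult_left_mono mult_right_mono power_mono zero_le)
          also have "\<dots> = c n * (R ^ (n - j) * R ^ (j - k)) * x ^ k"
            by (simp only: mult.assoc)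
          also have "\<dots> = c k * x ^ k"
            using False that by (simp add: ck flip: power_add)
          also have "\<dots> \<le> ?S"
            by (rule low) simp
          finally show ?thesis .
        qed (rule low)
        then have "(\<Sum>j\<le>n. c j * x ^ j) \<le> ?S"
          by (simp add: sum_le_iff)
        moreover have "?S \<le> (\<Sum>j\<le>n. c j * x ^ j)"
          using k(1) by (intro sum_mono2) (auto simp: zero_le)
        ultimately have "(\<Sum>j\<le>n. c j * x ^ j) = ?S"
          by (rule antisym)
        moreover have "x + R = R"
          using \<open>x \<le> R\<close> by (simp add: add_eq_max)
        ultimately show ?thesis
          \<comment> \<open>The power \<open>R ^ (n - k)\<close> contained in \<open>c k\<close> is
            exactly the contribution of the new roots.\<close>
          unfolding prod_r' r ck by (simp only: ac_simps)
      qed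
      then show ?thesis by blast
    qed
  qed
qed

lemma radicable_imp_alg_closed:
  assumes "radicable TYPE('a::{idempotent_semifield, linorder})"
  shows "alg_closed_semifield TYPE('a)"
  unfolding alg_closed_semifield_def poly_altdef
proof (intro allI impI)
  fix p :: "'a poly"
  assume "degree p > 0"
  then have "lead_coeff p \<noteq> 0" by auto
  then show "\<exists>r. \<forall>x. (\<Sum>i\<le>degree p. coeff p i * x ^ i) = lead_coeff p * (\<Prod>i=1..degree p. (x + r i))"
    by (rule radicable_sum_factorization[OF assms])
qed

theorem corollary7p10:
  shows "(order_dense TYPE('a::{idempotent_semifield, linorder}) \<and> alg_closed_semifield TYPE('a)
            \<longleftrightarrow> order_dense TYPE('a) \<and> preradicable TYPE('a)) \<and>
         (order_dense TYPE('a) \<and> preradicable TYPE('a) \<longleftrightarrow> radicable TYPE('a))"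
  using alg_closed_imp_radicable preradicable_imp_radicable radicable_imp_alg_closed
    radicable_imp_order_dense radicable_imp_preradicable by blast

end
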